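(* A group $\mathcal{G}$ admits a faithful representation with tropical $n$-by-$n$ matrices (i.e. $\mathcal{G}$ is isomorphic to a subgroup of the semigroup $(\overline{\mathbb{R}}^{n\times n},\otimes)$) if and only if $\mathcal{G}$ is isomorphic to a subgroup of the wreath product $\mathbb{R}\wr\mathcal{S}_n$.
   Context: The tropical semiring is $\overline{\mathbb{R}}=\mathbb{R}\cup\{-\infty\}$ with $a\oplus b=\max\{a,b\}$ and $a\otimes b=a+b$. Tropical matrix multiplication: $(X\otimes Y)_{ij}=\max_k (x_{ik}+y_{kj})$. A subgroup of the semigroup $(\overline{\mathbb{R}}^{n\times n},\otimes)$ is a subset that is a group under $\otimes$ (its identity need not be the tropical identity matrix). $\mathcal{S}_n$ is the symmetric group on $\{1,\ldots,n\}$, and $\mathbb{R}\wr\mathcal{S}_n$ is the (permutational) wreath product of the additive group $(\mathbb{R},+)$ by $\mathcal{S}_n$, i.e. the semidirect product $\mathbb{R}^n\rtimes\mathcal{S}_n$ where $\mathcal{S}_n$ acts on $\mathbb{R}^n$ by permuting coordinates. *)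

theory Defs
  imports
    "HOL-Library.Extended_Real"
    "HOL-Algebra.Product_Groups"
    "HOL-Algebra.Sym_Groups"
    "Jordan_Normal_Form.Matrix"
begin

text \<open>The tropical (max-plus) semiring. Its instance as a commutative semiring makes the matrix
  product of \<^theory>\<open>Jordan_Normal_Form.Matrix\<close> the tropical one; see
  \<open>tropical_mat_mult_index\<close> below.\<close>

typedef tropical = "{x :: ereal. x \<noteq> \<infinity>}"
  by (rule exI[of _ 0]) simp

setup_lifting type_definition_tropical

instantiation tropical :: comm_semiring_1
begin

lift_definition zero_tropical :: tropical is "- \<infinity>" by simp
lift_definition one_tropical :: tropical is 0 by simp
lift_definition plus_tropical :: "tropical \<Rightarrow> tropical \<Rightarrow> tropical" is max
  by (simp add: max_def)
lift_definition times_tropical :: "tropical \<Rightarrow> tropical \<Rightarrow> tropical" is "(+)"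
  by simp

instance
proof
  fix a b c :: tropical
  show "a * b * c = a * (b * c)" by transfer (simp add: add.assoc)
  show "a * b = b * a" by transfer (simp add: add.commute)
  show "1 * a = a" by transfer simp
  show "a + b + c = a + (b + c)" by transfer (simp add: max.assoc)
  show "a + b = b + a" by transfer (simp add: max.commute)
  show "0 + a = a" by transfer simp
  show "0 * a = 0" by transfer (auto simp: plus_ereal.simps)
  show "a * 0 = 0" by transfer (auto simp: plus_ereal.simps)
  show "(a + b) * c = a * c + b * c"
    by transfer (metis (no_types, lifting) add_right_mono max.absorb1 max.absorb2 nle_le)
  show "(0 :: tropical) \<noteq> 1" by transfer simp
qed

end

lemma Rep_tropical_sum:
  assumes "finite A" "A \<noteq> {}"
  shows "Rep_tropical (sum f A) = (MAX k\<in>A. Rep_tropical (f k))"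
  using assms
proof (induction A rule: finite_ne_induct)
  case (singleton x)
  then show ?case by simp
next
  case (insert x F)
  then show ?case by (simp add: plus_tropical.rep_eq)
qed

lemma tropical_mat_mult_index:
  assumes "X \<in> carrier_mat n n" "Y \<in> carrier_mat n n" "i < n" "j < n"
  shows "Rep_tropical ((X * Y) $$ (i, j)) =
    (MAX k\<in>{0..<n}. Rep_tropical (X $$ (i, k)) + Rep_tropical (Y $$ (k, j)))"
proof -
  have "(X * Y) $$ (i, j) = (\<Sum>k\<in>{0..<n}. X $$ (i, k) * Y $$ (k, j))"
    using assms by (auto simp: scalar_prod_def intro!: sum.cong)
  then show ?thesis
    using assms by (simp add: Rep_tropical_sum times_tropical.rep_eq)
qed

definition tropical_mat_monoid :: "nat \<Rightarrow> tropical mat monoid" where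
  "tropical_mat_monoid n = \<lparr>carrier = carrier_mat n n, monoid.mult = (*), one = 1\<^sub>m n\<rparr>"

text \<open>A subgroup of a semigroup: a subset that is a group under the restricted multiplication, with
  an identity \<open>e\<close> of its own. The \<open>one\<close> field of \<open>S\<close> is disregarded; in contrast,
  the locale \<^locale>\<open>subgroup\<close> would force \<open>e = \<one>\<^bsub>S\<^esub>\<close>.\<close>

definition semigroup_subgroup :: "'a set \<Rightarrow> 'a \<Rightarrow> ('a, 'b) monoid_scheme \<Rightarrow> bool" where
  "semigroup_subgroup H e S \<longleftrightarrow> H \<subseteq> carrier S \<and> group (S\<lparr>carrier := H, one := e\<rparr>)"

definition has_faithful_tropical_rep :: "('a, 'b) monoid_scheme \<Rightarrow> nat \<Rightarrow> bool" where
  "has_faithful_tropical_rep G n \<longleftrightarrow>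
    (\<exists>H e. semigroup_subgroup H e (tropical_mat_monoid n) \<and>
      G \<cong> (tropical_mat_monoid n)\<lparr>carrier := H, one := e\<rparr>)"

definition semidirect_product ::
  "('a, 'c) monoid_scheme \<Rightarrow> ('b, 'd) monoid_scheme \<Rightarrow> ('b \<Rightarrow> 'a \<Rightarrow> 'a) \<Rightarrow> ('a \<times> 'b) monoid" where
  "semidirect_product N H act =
    \<lparr>carrier = carrier N \<times> carrier H,
     monoid.mult = (\<lambda>(a, p) (b, q). (a \<otimes>\<^bsub>N\<^esub> act p b, p \<otimes>\<^bsub>H\<^esub> q)),
     one = (\<one>\<^bsub>N\<^esub>, \<one>\<^bsub>H\<^esub>)\<rparr>"

text \<open>The inverse makes this a left action, since multiplication in \<^const>\<open>sym_group\<close> is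
  composition of functions.\<close>

definition permute_coords :: "nat \<Rightarrow> (nat \<Rightarrow> nat) \<Rightarrow> (nat \<Rightarrow> 'a) \<Rightarrow> nat \<Rightarrow> 'a" where
  "permute_coords n p a = (\<lambda>i\<in>{1..n}. a (inv_into UNIV p i))"

definition wreath_sym :: "('a, 'c) monoid_scheme \<Rightarrow> nat \<Rightarrow> ((nat \<Rightarrow> 'a) \<times> (nat \<Rightarrow> nat)) monoid" where
  "wreath_sym A n =
    semidirect_product (product_group {1..n} (\<lambda>_. A)) (sym_group n) (permute_coords n)"

definition real_group :: "real monoid" where
  "real_group = \<lparr>carrier = UNIV, monoid.mult = (+), one = 0\<rparr>"

lemma group_real_group: "group real_group"
  by (rule groupI) (auto simp: real_group_def intro: exI[of _ "- x" for x])

lemma group_wreath_sym: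
  assumes A: "group A"
  shows "group (wreath_sym A n)"
proof -
  interpret A: group A by (rule A)
  have inv_in: "inv_into UNIV p i \<in> {1..n}" if "p permutes {1..n}" "i \<in> {1..n}" for p i
    using that permutes_in_image[OF permutes_inv] by metis
  have comp_inv: "inv_into UNIV (p \<circ> q) i = inv_into UNIV q (inv_into UNIV p i)"
    if "p permutes {1..n}" "q permutes {1..n}" for p q i
    using that by (simp add: o_inv_distrib permutes_bij)
  show ?thesis
  proof (rule groupI)
    show "\<one>\<^bsub>wreath_sym A n\<^esub> \<in> carrier (wreath_sym A n)"
      by (auto simp: wreath_sym_def semidirect_product_def sym_group_def permutes_id)
  next
    fix x y assume "x \<in> carrier (wreath_sym A n)" "y \<in> carrier (wreath_sym A n)"
    then show "x \<otimes>\<^bsub>wreath_sym A n\<^esub> y \<in> carrier (wreath_sym A n)"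
      using inv_in
      by (auto simp: wreath_sym_def semidirect_product_def sym_group_def permutes_compose
          permute_coords_def product_group_def PiE_iff simp del: atLeastAtMost_iff)
  next
    fix x y z
    assume "x \<in> carrier (wreath_sym A n)" "y \<in> carrier (wreath_sym A n)"
      "z \<in> carrier (wreath_sym A n)"
    then show "x \<otimes>\<^bsub>wreath_sym A n\<^esub> y \<otimes>\<^bsub>wreath_sym A n\<^esub> z =
        x \<otimes>\<^bsub>wreath_sym A n\<^esub> (y \<otimes>\<^bsub>wreath_sym A n\<^esub> z)"
      using inv_in
      by (auto simp: wreath_sym_def semidirect_product_def sym_group_def comp_inv
          permute_coords_def product_group_def PiE_iff A.m_assoc fun_eq_iff
          simp del: atLeastAtMost_iff)
  next
    fix x assume "x \<in> carrier (wreath_sym A n)"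
    then show "\<one>\<^bsub>wreath_sym A n\<^esub> \<otimes>\<^bsub>wreath_sym A n\<^esub> x = x"
      by (auto simp: wreath_sym_def semidirect_product_def sym_group_def permute_coords_def
          product_group_def PiE_iff fun_eq_iff extensional_def simp del: atLeastAtMost_iff)
  next
    fix x assume "x \<in> carrier (wreath_sym A n)"
    then obtain a p where x: "x = (a, p)" and a: "a \<in> {1..n} \<rightarrow>\<^sub>E carrier A"
      and p: "p permutes {1..n}"
      by (auto simp: wreath_sym_def semidirect_product_def sym_group_def)
    let ?y = "(\<lambda>i\<in>{1..n}. inv\<^bsub>A\<^esub> (a (p i)), inv_into UNIV p)"
    have p_in: "p i \<in> {1..n} \<longleftrightarrow> i \<in> {1..n}" for i
      using permutes_in_image[OF p] .
    have "?y \<in> carrier (wreath_sym A n)"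
      using a p p_in
      by (auto simp: wreath_sym_def semidirect_product_def sym_group_def permutes_inv PiE_iff
          simp del: atLeastAtMost_iff)
    moreover have "?y \<otimes>\<^bsub>wreath_sym A n\<^esub> x = \<one>\<^bsub>wreath_sym A n\<^esub>"
      using a p p_in
      by (auto simp: x wreath_sym_def semidirect_product_def sym_group_def permute_coords_def
          product_group_def PiE_iff fun_eq_iff permutes_inv_o inv_inv_eq[OF permutes_bij[OF p]]
          permutes_inverses simp del: atLeastAtMost_iff)
    ultimately show "\<exists>y\<in>carrier (wreath_sym A n). y \<otimes>\<^bsub>wreath_sym A n\<^esub> x = \<one>\<^bsub>wreath_sym A n\<^esub>"
      by blast
  qed
qed

end

theory Submission
  imports Defs
begin

text \<open>A group of matrices with identity \<open>e\<close> acts on the column space of \<open>e\<close>. Choose a minimal set of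
  columns of \<open>e\<close> spanning that space. For \<open>g\<close> in the group with inverse \<open>h\<close>, expand the image of a
  chosen column \<open>b\<^sub>i\<close> under \<open>g\<close> and then under \<open>h\<close>: minimality forces the resulting coefficient of
  \<open>b\<^sub>i\<close> to be at least \<open>1\<close>, and since tropical sums are maxima, a single term \<open>j\<close> already contributes
  that much. Monotonicity of \<open>g\<close> then gives that \<open>g\<close> maps \<open>b\<^sub>i\<close> to a scalar multiple of \<open>b\<^sub>j\<close>. So
  every \<open>g\<close> permutes the chosen columns up to scalars, which is an element of the wreath product, and
  it is determined by this action because the chosen columns span. Conversely the wreath
  product is the group of monomial matrices.\<close>

declare One_nat_def [simp del]

section \<open>Order and units of the tropical semiring\<close>

text \<open>The order of the extended reals. Both operations are monotone for it, so tropical sums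
  and matrix products can be compared term by term.\<close>

instantiation tropical :: "{linorder, ordered_comm_semiring}"
begin

lift_definition less_eq_tropical :: "tropical \<Rightarrow> tropical \<Rightarrow> bool" is "(\<le>)" .
lift_definition less_tropical :: "tropical \<Rightarrow> tropical \<Rightarrow> bool" is "(<)" .

instance
proof
  fix a b c :: tropical
  show "a < b \<longleftrightarrow> a \<le> b \<and> \<not> b \<le> a" by transfer auto
  show "a \<le> a" by transfer simp
  show "a \<le> b \<Longrightarrow> b \<le> c \<Longrightarrow> a \<le> c" by transfer simp
  show "a \<le> b \<Longrightarrow> b \<le> a \<Longrightarrow> a = b" by transfer simp
  show "a \<le> b \<or> b \<le> a" by transfer auto
  show "a \<le> b \<Longrightarrow> c + a \<le> c + b" by transfer (simp add: max.coboundedI2)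
  show "a \<le> b \<Longrightarrow> 0 \<le> c \<Longrightarrow> c * a \<le> c * b" by transfer (simp add: add_left_mono)
qed

end

lemma tropical_zero_le: "0 \<le> (x :: tropical)"
  by transfer simp

lemma tropical_le_add_iff: "(y :: tropical) \<le> x + z \<longleftrightarrow> y \<le> x \<or> y \<le> z"
  by transfer (rule le_max_iff_disj)

text \<open>A tropical sum is a maximum and is attained by one of its terms. The empty sum is
  \<open>0\<close>, that is, minus infinity, which is why \<open>y\<close> must be nonzero.\<close>

lemma tropical_le_sum_iff:
  fixes f :: "'i \<Rightarrow> tropical"
  assumes "finite A" "y \<noteq> 0"
  shows "y \<le> sum f A \<longleftrightarrow> (\<exists>i\<in>A. y \<le> f i)"
  using assms(1)
proof (induction A)
  case empty
  then show ?case using assms(2) tropical_zero_le[of y] by auto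
next
  case (insert x F)
  then show ?case by (simp add: tropical_le_add_iff)
qed

text \<open>Scaling by \<open>c < 1\<close> strictly decreases every finite \<open>x\<close>, so the
  maximum must come from \<open>s\<close>. This replaces the subtraction that a semiring
  lacks.\<close>

lemma tropical_eq_if_scale_less_one:
  fixes x :: tropical
  assumes "c < 1" "x = c * x + s"
  shows "x = s"
  using assms
proof transfer
  fix c x s :: ereal
  assume *: "c \<noteq> \<infinity>" "x \<noteq> \<infinity>" "s \<noteq> \<infinity>" "c < 0" "x = max (c + x) s"
  then show "x = s"
    by (cases c; cases x) (auto simp: max_def split: if_splits)
qed

text \<open>Identifies the additive group of the reals with the units of the semiring, so that the
  scalars multiplying columns become elements of \<open>real_group\<close>.\<close>

lift_definition tropical_of_real :: "real \<Rightarrow> tropical" is ereal by simp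

lemma tropical_of_real_0 [simp]: "tropical_of_real 0 = 1"
  by transfer (simp add: zero_ereal_def)

lemma tropical_of_real_add: "tropical_of_real (r + s) = tropical_of_real r * tropical_of_real s"
  by transfer simp

lemma tropical_of_real_nonzero [simp]: "tropical_of_real r \<noteq> 0"
  by transfer simp

lemma tropical_of_real_eq_iff [simp]: "tropical_of_real r = tropical_of_real s \<longleftrightarrow> r = s"
  by transfer simp

lemma tropical_nonzeroE:
  assumes "x \<noteq> 0"
  obtains r where "x = tropical_of_real r"
proof -
  have "\<exists>r. x = tropical_of_real r"
    using assms by transfer (metis MInfty_eq_minfinity PInfty_eq_infinity ereal.exhaust)
  then show ?thesis using that by blast
qed

lemma tropical_of_real_mult_inj:
  assumes "tropical_of_real r * x = tropical_of_real s * x" "x \<noteq> 0"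
  shows "r = s"
proof -
  obtain u where "x = tropical_of_real u" using assms(2) by (rule tropical_nonzeroE)
  with assms(1) show ?thesis by (simp flip: tropical_of_real_add)
qed

section \<open>Minimal spanning sets of columns\<close>

text \<open>Columns are numbered from \<open>1\<close>, as are the coordinates permuted by \<^const>\<open>sym_group\<close>.\<close>

definition column_in_span :: "tropical mat \<Rightarrow> nat set \<Rightarrow> nat \<Rightarrow> bool" where
  "column_in_span A J i \<longleftrightarrow>
    (\<exists>c. \<forall>t<dim_row A. A $$ (t, i - 1) = (\<Sum>k\<in>J. c k * A $$ (t, k - 1)))"

lemma column_in_span_mem:
  assumes "finite J" "i \<in> J"
  shows "column_in_span A J i"
  unfolding column_in_span_def
  using assms
  by (intro exI[of _ "\<lambda>k. if k = i then 1 else 0"])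
    (simp add: if_distrib[of "\<lambda>c. c * _"] sum.delta cong: if_cong)

text \<open>Substitute the expansion of column \<open>i\<close> into that of column
  \<open>j\<close>. No subtraction occurs, so this works over a semiring.\<close>

lemma column_in_span_remove:
  assumes fin: "finite J" and i: "i \<in> J"
    and "column_in_span A (J - {i}) i" "column_in_span A J j"
  shows "column_in_span A (J - {i}) j"
proof -
  obtain c where c: "\<And>t. t < dim_row A \<Longrightarrow>
      A $$ (t, j - 1) = (\<Sum>k\<in>J. c k * A $$ (t, k - 1))"
    using assms(4) unfolding column_in_span_def by blast
  obtain d where d: "\<And>t. t < dim_row A \<Longrightarrow>
      A $$ (t, i - 1) = (\<Sum>k\<in>J - {i}. d k * A $$ (t, k - 1))"
    using assms(3) unfolding column_in_span_def by blast
  have "A $$ (t, j - 1) = (\<Sum>k\<in>J - {i}. (c i * d k + c k) * A $$ (t, k - 1))"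
    if t: "t < dim_row A" for t
  proof -
    have "A $$ (t, j - 1) =
        c i * A $$ (t, i - 1) + (\<Sum>k\<in>J - {i}. c k * A $$ (t, k - 1))"
      unfolding c[OF t] using fin i by (rule sum.remove)
    also have "\<dots> = (\<Sum>k\<in>J - {i}. (c i * d k + c k) * A $$ (t, k - 1))"
      by (simp add: d[OF t] sum_distrib_left sum.distrib distrib_right mult.assoc)
    finally show ?thesis .
  qed
  then show ?thesis
    unfolding column_in_span_def by (intro exI[of _ "\<lambda>k. c i * d k + c k"]) blast
qed

text \<open>Take a spanning set of least cardinality; a column spanned by the others could be
  discarded from it.\<close>

lemma minimal_spanning_columns:
  obtains I where "I \<subseteq> {1..n}" "\<And>j. j \<in> {1..n} \<Longrightarrow> column_in_span A I j"
    "\<And>i. i \<in> I \<Longrightarrow> \<not> column_in_span A (I - {i}) i"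
proof -
  define P where "P I \<longleftrightarrow> I \<subseteq> {1..n} \<and> (\<forall>j\<in>{1..n}. column_in_span A I j)" for I
  have "P {1..n}" by (auto simp: P_def intro: column_in_span_mem)
  then obtain I where I: "P I" and least: "\<And>J. P J \<Longrightarrow> card I \<le> card J"
    using ex_has_least_nat[of P _ card] by blast
  have fin: "finite I" using I finite_subset by (auto simp: P_def)
  have "\<not> column_in_span A (I - {i}) i" if i: "i \<in> I" for i
  proof
    assume "column_in_span A (I - {i}) i"
    then have "P (I - {i})"
      using I column_in_span_remove[OF fin i] by (auto simp: P_def)
    then show False
      using least[of "I - {i}"] card_Diff1_less[OF fin i] by simp
  qed
  with that[of I] I show ?thesis by (auto simp: P_def)
qed

section \<open>The monomial action on a minimal spanning set\<close>

text \<open>The identity \<open>e\<close> is an idempotent that may differ from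
  \<open>1\<^sub>m n\<close>, so \<open>I\<close> may be a proper subset of
  \<open>{1..n}\<close>.\<close>

locale tropical_matrix_group =
  fixes n :: nat and H :: "tropical mat set" and e :: "tropical mat" and I :: "nat set"
  assumes H_carrier: "H \<subseteq> carrier_mat n n"
    and e_H: "e \<in> H"
    and mult_H: "g \<in> H \<Longrightarrow> h \<in> H \<Longrightarrow> g * h \<in> H"
    and e_left: "g \<in> H \<Longrightarrow> e * g = g"
    and e_right: "g \<in> H \<Longrightarrow> g * e = g"
    and inverse_H: "g \<in> H \<Longrightarrow> \<exists>h\<in>H. h * g = e \<and> g * h = e"
    and I_subset: "I \<subseteq> {1..n}"
    and span_I: "j \<in> {1..n} \<Longrightarrow> column_in_span e I j"
    and indep_I: "i \<in> I \<Longrightarrow> \<not> column_in_span e (I - {i}) i"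
begin

section \<open>Columns of group elements expanded in the chosen columns\<close>

lemma finite_I: "finite I"
  using I_subset finite_subset by auto

lemma I_bounds:
  assumes "i \<in> I" shows "i - 1 < n"
  using assms I_subset by (auto simp: subset_iff)

lemma dim_e [simp]: "dim_row e = n"
  using e_H H_carrier by auto

lemma mult_index:
  assumes "g \<in> H" "h \<in> H" "t < n" "j < n"
  shows "(g * h) $$ (t, j) = (\<Sum>k<n. g $$ (t, k) * h $$ (k, j))"
proof -
  have "g \<in> carrier_mat n n" "h \<in> carrier_mat n n" using assms H_carrier by auto
  with assms show ?thesis by (auto simp: scalar_prod_def atLeast0LessThan intro!: sum.cong)
qed

text \<open>Because \<open>g = e * g\<close>, the columns of \<open>g\<close> are combinations of
  columns of \<open>e\<close>, hence of the chosen ones.\<close>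

lemma H_spanned:
  assumes g: "g \<in> H" and j: "j < n"
  shows "\<exists>c. \<forall>t<n. g $$ (t, j) = (\<Sum>i\<in>I. c i * e $$ (t, i - 1))"
proof -
  have "\<exists>c. \<forall>t<n. e $$ (t, k) = (\<Sum>i\<in>I. c i * e $$ (t, i - 1))" if "k < n" for k
    using span_I[of "Suc k"] that by (simp add: column_in_span_def)
  then obtain c where
    c: "\<And>k t. k < n \<Longrightarrow> t < n \<Longrightarrow> e $$ (t, k) = (\<Sum>i\<in>I. c k i * e $$ (t, i - 1))"
    by metis
  have "g $$ (t, j) = (\<Sum>i\<in>I. (\<Sum>k<n. c k i * g $$ (k, j)) * e $$ (t, i - 1))"
    if t: "t < n" for t
  proof -
    have "g $$ (t, j) = (\<Sum>k<n. e $$ (t, k) * g $$ (k, j))"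
      using mult_index[OF e_H g t j] by (simp add: e_left[OF g])
    also have "\<dots> = (\<Sum>k<n. \<Sum>i\<in>I. c k i * g $$ (k, j) * e $$ (t, i - 1))"
      using t by (simp add: c sum_distrib_left sum_distrib_right mult_ac)
    also have "\<dots> = (\<Sum>i\<in>I. (\<Sum>k<n. c k i * g $$ (k, j)) * e $$ (t, i - 1))"
      by (subst sum.swap) (simp add: sum_distrib_right)
    finally show ?thesis .
  qed
  then show ?thesis by (intro exI[of _ "\<lambda>i. \<Sum>k<n. c k i * g $$ (k, j)"]) blast
qed

text \<open>Left multiplication by \<open>h\<close> is linear, and \<open>h * e = h\<close> says
  that it maps column \<open>i\<close> of \<open>e\<close> to column \<open>i\<close> of
  \<open>h\<close>.\<close>

lemma mult_combination:
  assumes g: "g \<in> H" and h: "h \<in> H" and t: "t < n" and j: "j < n" and J: "J \<subseteq> I"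
    and c: "\<And>k. k < n \<Longrightarrow> g $$ (k, j) = (\<Sum>i\<in>J. c i * e $$ (k, i - 1))"
  shows "(h * g) $$ (t, j) = (\<Sum>i\<in>J. c i * h $$ (t, i - 1))"
proof -
  have "(h * g) $$ (t, j) = (\<Sum>k<n. \<Sum>i\<in>J. c i * (h $$ (t, k) * e $$ (k, i - 1)))"
    unfolding mult_index[OF h g t j] by (simp add: c sum_distrib_left mult_ac)
  also have "\<dots> = (\<Sum>i\<in>J. c i * (\<Sum>k<n. h $$ (t, k) * e $$ (k, i - 1)))"
    by (subst sum.swap) (simp add: sum_distrib_left)
  also have "\<dots> = (\<Sum>i\<in>J. c i * h $$ (t, i - 1))"
  proof (rule sum.cong[OF refl])
    fix i assume "i \<in> J"
    then have "i - 1 < n" using J I_bounds by blast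
    from mult_index[OF h e_H t this]
    show "c i * (\<Sum>k<n. h $$ (t, k) * e $$ (k, i - 1)) = c i * h $$ (t, i - 1)"
      by (simp add: e_right[OF h])
  qed
  finally show ?thesis .
qed

text \<open>If \<open>c i < 1\<close>, the term at \<open>i\<close> could be dropped from the
  expansion of column \<open>i\<close>, contradicting the minimality of \<open>I\<close>.\<close>

lemma diagonal_coefficient_ge_1:
  assumes i: "i \<in> I" and c: "\<And>t. t < n \<Longrightarrow> e $$ (t, i - 1) = (\<Sum>k\<in>I. c k * e $$ (t, k - 1))"
  shows "1 \<le> c i"
proof (rule ccontr)
  assume "\<not> 1 \<le> c i"
  then have less: "c i < 1" by simp
  have "e $$ (t, i - 1) = (\<Sum>k\<in>I - {i}. c k * e $$ (t, k - 1))" if t: "t < n" for t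
  proof (rule tropical_eq_if_scale_less_one[OF less])
    show "e $$ (t, i - 1) = c i * e $$ (t, i - 1) + (\<Sum>k\<in>I - {i}. c k * e $$ (t, k - 1))"
      using c[OF t] sum.remove[OF finite_I i, of "\<lambda>k. c k * e $$ (t, k - 1)"] by simp
  qed
  then have "column_in_span e (I - {i}) i" by (auto simp: column_in_span_def)
  with indep_I[OF i] show False by simp
qed

text \<open>For \<open>g\<close> in \<open>H\<close>, column \<open>i\<close> of \<open>g\<close> is
  the image under \<open>g\<close> of column \<open>i\<close> of \<open>e\<close>. So this is an
  arrow from \<open>i\<close> to \<open>j\<close> of weight \<open>r\<close>.\<close>

definition sends :: "tropical mat \<Rightarrow> nat \<Rightarrow> nat \<Rightarrow> real \<Rightarrow> bool" where
  "sends g i j r \<longleftrightarrow> j \<in> I \<and> (\<forall>t<n. g $$ (t, i - 1) = tropical_of_real r * e $$ (t, j - 1))"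

lemma sends_exists:
  assumes g: "g \<in> H" and i: "i \<in> I"
  shows "\<exists>j r. sends g i j r"
proof -
  obtain h where h: "h \<in> H" and hg: "h * g = e" and gh: "g * h = e"
    using inverse_H[OF g] by blast
  obtain a where a: "\<And>t. t < n \<Longrightarrow> g $$ (t, i - 1) = (\<Sum>j\<in>I. a j * e $$ (t, j - 1))"
    using H_spanned[OF g I_bounds[OF i]] by blast
  have "\<exists>b. \<forall>t<n. h $$ (t, j - 1) = (\<Sum>k\<in>I. b k * e $$ (t, k - 1))" if "j \<in> I" for j
    using H_spanned[OF h I_bounds[OF that]] .
  then obtain b where
    b: "\<And>j t. j \<in> I \<Longrightarrow> t < n \<Longrightarrow> h $$ (t, j - 1) = (\<Sum>k\<in>I. b j k * e $$ (t, k - 1))"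
    by metis
  \<comment> \<open>Apply \<open>h\<close> to the expansion \<open>a\<close> of the image of column
    \<open>i\<close>, then expand each column of \<open>h\<close> by \<open>b\<close>.\<close>
  have "e $$ (t, i - 1) = (\<Sum>k\<in>I. (\<Sum>j\<in>I. a j * b j k) * e $$ (t, k - 1))" if t: "t < n" for t
  proof -
    have "e $$ (t, i - 1) = (\<Sum>j\<in>I. a j * h $$ (t, j - 1))"
      using mult_combination[OF g h t I_bounds[OF i] order_refl a] by (simp add: hg)
    also have "\<dots> = (\<Sum>j\<in>I. \<Sum>k\<in>I. a j * b j k * e $$ (t, k - 1))"
      using t by (simp add: b sum_distrib_left mult_ac)
    also have "\<dots> = (\<Sum>k\<in>I. (\<Sum>j\<in>I. a j * b j k) * e $$ (t, k - 1))"
      by (subst sum.swap) (simp add: sum_distrib_right)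
    finally show ?thesis .
  qed
  then have "1 \<le> (\<Sum>j\<in>I. a j * b j i)"
    by (rule diagonal_coefficient_ge_1[OF i])
  then obtain j where j: "j \<in> I" and ab: "1 \<le> a j * b j i"
    using tropical_le_sum_iff[OF finite_I] by auto
  then have "a j \<noteq> 0" using tropical_zero_le[of 1] by (metis mult_zero_left order_antisym zero_neq_one)
  then obtain r where r: "a j = tropical_of_real r" by (rule tropical_nonzeroE)
  have "g $$ (t, i - 1) = a j * e $$ (t, j - 1)" if t: "t < n" for t
  proof (rule order_antisym)
    show "a j * e $$ (t, j - 1) \<le> g $$ (t, i - 1)"
      unfolding a[OF t] by (rule member_le_sum) (use j finite_I tropical_zero_le in auto)
    \<comment> \<open>One term of the expansion of column \<open>j\<close> of \<open>h\<close>
      bounds that column from below. Applying \<open>g\<close>, which undoes \<open>h\<close>,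
      bounds \<open>b j i\<close> times column \<open>i\<close> of \<open>g\<close> by column
      \<open>j\<close> of \<open>e\<close>; multiplying by \<open>a j\<close> then uses
      \<open>ab\<close>.\<close>
    have "b j i * g $$ (t, i - 1) = (\<Sum>k<n. g $$ (t, k) * (b j i * e $$ (k, i - 1)))"
      using mult_index[OF g e_H t I_bounds[OF i]]
      by (simp add: e_right[OF g] sum_distrib_left mult_ac)
    also have "\<dots> \<le> (\<Sum>k<n. g $$ (t, k) * h $$ (k, j - 1))"
    proof (rule sum_mono)
      fix k assume "k \<in> {..<n}"
      then have "b j i * e $$ (k, i - 1) \<le> h $$ (k, j - 1)"
        using member_le_sum[OF i _ finite_I, of "\<lambda>l. b j l * e $$ (k, l - 1)"] tropical_zero_le
        by (simp add: b[OF j])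
      then show "g $$ (t, k) * (b j i * e $$ (k, i - 1)) \<le> g $$ (t, k) * h $$ (k, j - 1)"
        by (rule mult_left_mono) (rule tropical_zero_le)
    qed
    also have "\<dots> = e $$ (t, j - 1)"
      using mult_index[OF g h t I_bounds[OF j]] by (simp add: gh)
    finally have le: "b j i * g $$ (t, i - 1) \<le> e $$ (t, j - 1)" .
    have "1 * g $$ (t, i - 1) \<le> (a j * b j i) * g $$ (t, i - 1)"
      using ab tropical_zero_le by (rule mult_right_mono)
    also have "\<dots> \<le> a j * e $$ (t, j - 1)"
      using mult_left_mono[OF le tropical_zero_le[of "a j"]] by (simp add: mult_ac)
    finally show "g $$ (t, i - 1) \<le> a j * e $$ (t, j - 1)" by simp
  qed
  then show ?thesis using j r unfolding sends_def by metis
qed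

text \<open>Two different heads would make one chosen column a multiple of another. For equal heads
  the weights agree, since a column with a nonzero entry determines its scalar.\<close>

lemma sends_unique:
  assumes "sends g i j r" "sends g i k s"
  shows "j = k \<and> r = s"
proof -
  have j: "j \<in> I" and k: "k \<in> I"
    and eq: "\<And>t. t < n \<Longrightarrow>
      tropical_of_real r * e $$ (t, j - 1) = tropical_of_real s * e $$ (t, k - 1)"
    using assms by (auto simp: sends_def)
  have jk: "j = k"
  proof (rule ccontr)
    assume neq: "j \<noteq> k"
    have "e $$ (t, j - 1) = (\<Sum>l\<in>I - {j}. (if l = k then tropical_of_real (s - r) else 0)
        * e $$ (t, l - 1))" if t: "t < n" for t
    proof -
      have "e $$ (t, j - 1) = tropical_of_real (- r) * (tropical_of_real r * e $$ (t, j - 1))"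
        by (simp flip: mult.assoc tropical_of_real_add)
      also have "\<dots> = tropical_of_real (s - r) * e $$ (t, k - 1)"
        by (simp add: eq[OF t] flip: mult.assoc tropical_of_real_add)
      also have "\<dots> = (\<Sum>l\<in>I - {j}. (if l = k then tropical_of_real (s - r) else 0)
          * e $$ (t, l - 1))"
        using neq k finite_I
        by (simp add: if_distrib[of "\<lambda>c. c * _"] sum.delta cong: if_cong)
      finally show ?thesis .
    qed
    then have "column_in_span e (I - {j}) j"
      unfolding column_in_span_def dim_e
      by (intro exI[of _ "\<lambda>l. if l = k then tropical_of_real (s - r) else 0"]) blast
    with indep_I[OF j] show False by simp
  qed
  \<comment> \<open>A zero column lies in every span, so minimality excludes it.\<close>
  have "\<exists>t<n. e $$ (t, j - 1) \<noteq> 0"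
  proof (rule ccontr)
    assume "\<not> (\<exists>t<n. e $$ (t, j - 1) \<noteq> 0)"
    then have "column_in_span e (I - {j}) j"
      unfolding column_in_span_def dim_e by (intro exI[of _ "\<lambda>_. 0"]) simp
    with indep_I[OF j] show False by simp
  qed
  then obtain t where t: "t < n" "e $$ (t, j - 1) \<noteq> 0" by blast
  then have "r = s"
    using eq[OF t(1)] by (intro tropical_of_real_mult_inj) (simp_all add: jk)
  with jk show ?thesis by simp
qed

lemma sends_mult:
  assumes g: "g \<in> H" and h: "h \<in> H" and i: "i \<in> I"
    and gi: "sends g i j r" and hj: "sends h j k s"
  shows "sends (h * g) i k (r + s)"
proof -
  have j: "j \<in> I" using gi by (simp add: sends_def)
  have "(h * g) $$ (t, i - 1) = tropical_of_real (r + s) * e $$ (t, k - 1)" if t: "t < n" for t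
  proof -
    \<comment> \<open>The expansion of column \<open>i\<close> of \<open>g\<close> has the single
      term \<open>j\<close>.\<close>
    have "(h * g) $$ (t, i - 1) = (\<Sum>l\<in>{j}. tropical_of_real r * h $$ (t, l - 1))"
      using gi j by (intro mult_combination[OF g h t I_bounds[OF i]]) (auto simp: sends_def)
    then show ?thesis
      using hj t by (simp add: sends_def tropical_of_real_add mult.assoc)
  qed
  with hj show ?thesis by (simp add: sends_def)
qed

lemma sends_e:
  assumes "i \<in> I" shows "sends e i i 0"
  using assms by (simp add: sends_def)

text \<open>The defaults outside \<open>I\<close>, here \<open>i\<close> and for
  \<open>weight\<close> the value \<open>0\<close>, extend the action on \<open>I\<close> trivially
  to all indices and keep the composition rules valid there.\<close>

definition target :: "tropical mat \<Rightarrow> nat \<Rightarrow> nat" where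
  "target g i = (if i \<in> I then THE j. \<exists>r. sends g i j r else i)"

definition weight :: "tropical mat \<Rightarrow> nat \<Rightarrow> real" where
  "weight g i = (if i \<in> I then THE r. \<exists>j. sends g i j r else 0)"

lemma target_weight_eq:
  assumes "i \<in> I" "sends g i j r"
  shows "target g i = j" "weight g i = r"
proof -
  have "(THE j. \<exists>r. sends g i j r) = j" "(THE r. \<exists>j. sends g i j r) = r"
    using assms(2) sends_unique by blast+
  then show "target g i = j" "weight g i = r"
    using assms(1) by (simp_all add: target_def weight_def)
qed

lemma sends_target_weight:
  assumes "g \<in> H" "i \<in> I"
  shows "sends g i (target g i) (weight g i)"
proof -
  obtain j r where "sends g i j r" using sends_exists[OF assms] by blast
  then show ?thesis using target_weight_eq[OF assms(2)] by simp
qed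

lemma target_in_I_iff:
  assumes "g \<in> H"
  shows "target g i \<in> I \<longleftrightarrow> i \<in> I"
proof (cases "i \<in> I")
  case True
  with sends_target_weight[OF assms True] show ?thesis by (simp add: sends_def)
qed (simp add: target_def)

lemma target_weight_mult:
  assumes g: "g \<in> H" and h: "h \<in> H"
  shows "target (h * g) i = target h (target g i)"
    and "weight (h * g) i = weight g i + weight h (target g i)"
proof -
  have "target (h * g) i = target h (target g i) \<and>
      weight (h * g) i = weight g i + weight h (target g i)"
  proof (cases "i \<in> I")
    case True
    then show ?thesis
      using target_weight_eq[OF True sends_mult[OF g h True sends_target_weight[OF g True]
            sends_target_weight[OF h]]]
      by (simp add: target_in_I_iff[OF g])
  qed (simp add: target_def weight_def)
  then show "target (h * g) i = target h (target g i)"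
    and "weight (h * g) i = weight g i + weight h (target g i)" by auto
qed

lemma target_e: "target e i = i"
proof (cases "i \<in> I")
  case True
  then show ?thesis using target_weight_eq(1)[OF True sends_e] by simp
qed (simp add: target_def)

text \<open>The target map of the inverse matrix is a two-sided inverse.\<close>

lemma target_permutes:
  assumes g: "g \<in> H"
  shows "target g permutes {1..n}"
proof -
  obtain h where h: "h \<in> H" and hg: "h * g = e" and gh: "g * h = e"
    using inverse_H[OF g] by blast
  have "target h (target g i) = i" "target g (target h i) = i" for i
    using target_weight_mult(1)[OF g h, of i] target_weight_mult(1)[OF h g, of i]
    by (simp_all add: hg gh target_e)
  then have "bij (target g)"
    by (intro bij_betw_byWitness[where f' = "target h"]) auto
  moreover have "target g i = i" if "i \<notin> {1..n}" for i
    using that I_subset by (auto simp: target_def)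
  ultimately show ?thesis
    unfolding permutes_def bij_iff by blast
qed

text \<open>The weight of an arrow is recorded at its head, to match \<^const>\<open>permute_coords\<close>.\<close>

definition to_wreath :: "tropical mat \<Rightarrow> (nat \<Rightarrow> real) \<times> (nat \<Rightarrow> nat)" where
  "to_wreath g = (\<lambda>i\<in>{1..n}. weight g (inv_into UNIV (target g) i), target g)"

lemma to_wreath_carrier:
  assumes "g \<in> H"
  shows "to_wreath g \<in> carrier (wreath_sym real_group n)"
  using target_permutes[OF assms]
  by (auto simp: to_wreath_def wreath_sym_def semidirect_product_def sym_group_def
      product_group_def real_group_def)

text \<open>The arrow of \<open>h * g\<close> with head \<open>i\<close> is an arrow of
  \<open>g\<close> followed by the arrow of \<open>h\<close> with head \<open>i\<close>. The first
  one ends at the preimage of \<open>i\<close> under \<open>target h\<close>, where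
  \<open>permute_coords\<close> reads its weight.\<close>

lemma to_wreath_mult:
  assumes h: "h \<in> H" and g: "g \<in> H"
  shows "to_wreath (h * g) = to_wreath h \<otimes>\<^bsub>wreath_sym real_group n\<^esub> to_wreath g"
proof -
  note ph = target_permutes[OF h] and pg = target_permutes[OF g]
  have target: "target (h * g) = target h \<circ> target g"
    by (simp add: fun_eq_iff target_weight_mult[OF g h])
  have "weight (h * g) (inv_into UNIV (target (h * g)) i) =
      weight h (inv_into UNIV (target h) i)
        + weight g (inv_into UNIV (target g) (inv_into UNIV (target h) i))" for i
    using permutes_inverses(1)[OF pg]
    by (simp add: target o_inv_distrib permutes_bij[OF ph] permutes_bij[OF pg]
        target_weight_mult[OF g h])
  \<comment> \<open>Ensures that the restricted weight function of \<open>g\<close> is evaluated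
    inside its domain.\<close>
  moreover have "inv_into UNIV (target h) i \<in> {1..n}" if "i \<in> {1..n}" for i
    using permutes_in_image[OF permutes_inv[OF ph]] that by blast
  ultimately show ?thesis
    by (auto simp: to_wreath_def wreath_sym_def semidirect_product_def sym_group_def target
        product_group_def real_group_def permute_coords_def fun_eq_iff simp del: atLeastAtMost_iff)
qed

text \<open>Targets and weights fix the columns of \<open>g\<close> numbered by \<open>I\<close>.
  The coefficients that expand \<open>e\<close> express all columns of \<open>g = g * e\<close>
  through these, independently of \<open>g\<close>.\<close>

lemma inj_on_to_wreath: "inj_on to_wreath H"
proof (rule inj_onI)
  fix g h assume g: "g \<in> H" and h: "h \<in> H" and eq: "to_wreath g = to_wreath h"
  have target: "target g = target h" using eq by (simp add: to_wreath_def)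
  have weight: "weight g i = weight h i" if "i \<in> I" for i
  proof -
    have "target g i \<in> {1..n}"
      using that target_in_I_iff[OF g] I_subset by blast
    then have "weight g (inv_into UNIV (target g) (target g i)) =
        weight h (inv_into UNIV (target g) (target g i))"
      using eq by (auto simp: to_wreath_def target dest!: fun_cong[where x = "target g i"])
    then show ?thesis by (simp add: permutes_inverses(2)[OF target_permutes[OF g]])
  qed
  have column: "g $$ (t, i - 1) = h $$ (t, i - 1)" if "i \<in> I" "t < n" for t i
    using sends_target_weight[OF g that(1)] sends_target_weight[OF h that(1)] that(2)
    by (simp add: sends_def target weight[OF that(1)])
  show "g = h"
  proof (rule eq_matI)
    fix t j assume "t < dim_row h" "j < dim_col h"
    then have t: "t < n" and j: "j < n" using h H_carrier by auto
    obtain c where c: "\<And>k. k < n \<Longrightarrow> e $$ (k, j) = (\<Sum>i\<in>I. c i * e $$ (k, i - 1))"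
      using H_spanned[OF e_H j] by blast
    have "(g * e) $$ (t, j) = (\<Sum>i\<in>I. c i * g $$ (t, i - 1))"
      by (rule mult_combination[OF e_H g t j order_refl c])
    also have "\<dots> = (\<Sum>i\<in>I. c i * h $$ (t, i - 1))"
      by (simp add: column[OF _ t] cong: sum.cong)
    also have "\<dots> = (h * e) $$ (t, j)"
      by (rule mult_combination[OF e_H h t j order_refl c, symmetric])
    finally show "g $$ (t, j) = h $$ (t, j)" by (simp add: e_right[OF g] e_right[OF h])
  qed (use g h H_carrier in auto)
qed

end

section \<open>Monomial matrices\<close>

text \<open>The weight is indexed by the row, the head of the arrow, as in \<open>to_wreath\<close>;
  \<open>Suc\<close> turns matrix indices into numbers from \<open>1\<close> to
  \<open>n\<close>.\<close>

definition monomial_mat :: "nat \<Rightarrow> (nat \<Rightarrow> real) \<times> (nat \<Rightarrow> nat) \<Rightarrow> tropical mat" where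
  "monomial_mat n = (\<lambda>(a, p).
    mat n n (\<lambda>(i, j). if p (Suc j) = Suc i then tropical_of_real (a (Suc i)) else 0))"

lemma carrier_wreath_real:
  "carrier (wreath_sym real_group n) = ({1..n} \<rightarrow>\<^sub>E UNIV) \<times> {p. p permutes {1..n}}"
  by (simp add: wreath_sym_def semidirect_product_def sym_group_def product_group_def
      real_group_def)

lemma monomial_mat_mult:
  assumes "x \<in> carrier (wreath_sym real_group n)" "y \<in> carrier (wreath_sym real_group n)"
  shows "monomial_mat n (x \<otimes>\<^bsub>wreath_sym real_group n\<^esub> y) = monomial_mat n x * monomial_mat n y"
proof -
  obtain a p b q where x: "x = (a, p)" and y: "y = (b, q)"
    by (metis surj_pair)
  have p: "p permutes {1..n}" and q: "q permutes {1..n}"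
    using assms by (auto simp: x y carrier_wreath_real)
  have prod: "x \<otimes>\<^bsub>wreath_sym real_group n\<^esub> y =
      (\<lambda>i\<in>{1..n}. a i + b (inv_into UNIV p i), p \<circ> q)"
    by (auto simp: x y wreath_sym_def semidirect_product_def sym_group_def product_group_def
        real_group_def permute_coords_def fun_eq_iff)
  show ?thesis
  proof (rule eq_matI)
    fix i j
    assume "i < dim_row (monomial_mat n x * monomial_mat n y)"
      "j < dim_col (monomial_mat n x * monomial_mat n y)"
    then have i: "i < n" and j: "j < n" by (auto simp: monomial_mat_def x y)
    have "q (Suc j) \<in> {1..n}" using permutes_in_image[OF q, of "Suc j"] j by simp
    \<comment> \<open>Row \<open>l\<close> holds the only nonzero entry of column \<open>j\<close>
      of the second factor, so the sum collapses to \<open>k = l\<close>.\<close>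
    then obtain l where l: "q (Suc j) = Suc l" "l < n"
      by (cases "q (Suc j)") auto
    have "(monomial_mat n x * monomial_mat n y) $$ (i, j) =
        (\<Sum>k<n. (if p (Suc k) = Suc i then tropical_of_real (a (Suc i)) else 0)
          * (if k = l then tropical_of_real (b (Suc k)) else 0))"
      using i j l
      by (auto simp: monomial_mat_def x y scalar_prod_def atLeast0LessThan intro!: sum.cong)
    also have "\<dots> = (if p (Suc l) = Suc i
        then tropical_of_real (a (Suc i)) * tropical_of_real (b (Suc l)) else 0)"
      using l(2) by (simp add: if_distrib[of "\<lambda>c. _ * c"] sum.delta' sum.delta cong: if_cong)
    also have "\<dots> = monomial_mat n (x \<otimes>\<^bsub>wreath_sym real_group n\<^esub> y) $$ (i, j)"
      using i j l permutes_inverses(2)[OF p, of "Suc l"]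
      by (auto simp: prod monomial_mat_def tropical_of_real_add)
    finally show "monomial_mat n (x \<otimes>\<^bsub>wreath_sym real_group n\<^esub> y) $$ (i, j) =
        (monomial_mat n x * monomial_mat n y) $$ (i, j)" ..
  qed (simp_all add: prod monomial_mat_def x y case_prod_unfold)
qed

lemma inj_on_monomial_mat: "inj_on (monomial_mat n) (carrier (wreath_sym real_group n))"
proof (rule inj_onI)
  fix x y
  assume xy: "x \<in> carrier (wreath_sym real_group n)" "y \<in> carrier (wreath_sym real_group n)"
    and eq: "monomial_mat n x = monomial_mat n y"
  obtain a p b q where x: "x = (a, p)" and y: "y = (b, q)"
    by (metis surj_pair)
  have p: "p permutes {1..n}" and q: "q permutes {1..n}"
    and a: "a \<in> extensional {1..n}" and b: "b \<in> extensional {1..n}"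
    using xy by (auto simp: x y carrier_wreath_real PiE_def)
  have entry: "p (Suc j) = q (Suc j) \<and> a (p (Suc j)) = b (p (Suc j))" if j: "j < n" for j
  proof -
    have "p (Suc j) \<in> {1..n}" using permutes_in_image[OF p, of "Suc j"] j by simp
    then obtain i where i: "p (Suc j) = Suc i" "i < n"
      by (cases "p (Suc j)") auto
    have "monomial_mat n x $$ (i, j) = monomial_mat n y $$ (i, j)" by (simp add: eq)
    then show ?thesis
      using i j by (auto simp: monomial_mat_def x y split: if_splits)
  qed
  have "p k = q k" for k
  proof (cases "k \<in> {1..n}")
    case True
    then obtain j where "k = Suc j" "j < n" by (cases k) auto
    then show ?thesis using entry by simp
  next
    case False
    then show ?thesis using permutes_not_in[OF p] permutes_not_in[OF q] by simp
  qed
  \<comment> \<open>Every \<open>k\<close> is a head under \<open>p\<close>, so its weight occurs as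
    a matrix entry.\<close>
  moreover have "a k = b k" if k: "k \<in> {1..n}" for k
  proof -
    have "inv_into UNIV p k \<in> {1..n}"
      using permutes_in_image[OF permutes_inv[OF p]] k by blast
    then obtain j where j: "inv_into UNIV p k = Suc j" "j < n"
      by (cases "inv_into UNIV p k") auto
    then have "p (Suc j) = k"
      using permutes_inverses(1)[OF p, of k] by simp
    with entry[OF j(2)] show ?thesis by metis
  qed
  then have "a = b" using a b by (intro extensionalityI)
  ultimately show "x = y" by (auto simp: x y)
qed

section \<open>The two directions of the equivalence\<close>

lemma has_faithful_tropical_rep_if_wreath_subgroup:
  assumes "subgroup K (wreath_sym real_group n)"
    and iso: "G \<cong> (wreath_sym real_group n)\<lparr>carrier := K\<rparr>" (is "_ \<cong> ?K")
  shows "has_faithful_tropical_rep G n"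
proof -
  define f where "f = monomial_mat n"
  define M where "M = (tropical_mat_monoid n)\<lparr>carrier := f ` K\<rparr>"
  have K: "group ?K"
    using assms(1) group_wreath_sym[OF group_real_group]
    by (intro subgroup.subgroup_is_group)
  have K_subset: "K \<subseteq> carrier (wreath_sym real_group n)"
    by (rule subgroup.subset[OF assms(1)])
  have f_iso: "f \<in> iso ?K M"
  proof (rule isoI)
    show "f \<in> hom ?K M"
      using K_subset monomial_mat_mult
      by (intro homI) (auto simp: M_def f_def tropical_mat_monoid_def subset_iff)
    show "bij_betw f (carrier ?K) (carrier M)"
      using inj_on_subset[OF inj_on_monomial_mat K_subset] by (simp add: bij_betw_def M_def f_def)
  qed
  have "group (M\<lparr>one := f \<one>\<^bsub>?K\<^esub>\<rparr>)"
    by (rule group.iso_imp_img_group[OF K f_iso])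
  moreover have "f ` K \<subseteq> carrier (tropical_mat_monoid n)"
    by (auto simp: f_def monomial_mat_def tropical_mat_monoid_def)
  \<comment> \<open>Isomorphisms refer only to carriers and products, so changing the
    \<open>one\<close> field is harmless.\<close>
  moreover have "f \<in> iso ?K (M\<lparr>one := f \<one>\<^bsub>?K\<^esub>\<rparr>)"
    using f_iso by (simp add: iso_def hom_def)
  then have "G \<cong> M\<lparr>one := f \<one>\<^bsub>?K\<^esub>\<rparr>"
    using iso iso_trans unfolding is_iso_def by blast
  ultimately show ?thesis
    unfolding has_faithful_tropical_rep_def semigroup_subgroup_def M_def by auto
qed

lemma wreath_subgroup_if_has_faithful_tropical_rep:
  assumes "has_faithful_tropical_rep G n"
  shows "\<exists>K. subgroup K (wreath_sym real_group n) \<and>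
    G \<cong> (wreath_sym real_group n)\<lparr>carrier := K\<rparr>"
proof -
  obtain H e where "semigroup_subgroup H e (tropical_mat_monoid n)"
    and "G \<cong> (tropical_mat_monoid n)\<lparr>carrier := H, one := e\<rparr>"
    using assms unfolding has_faithful_tropical_rep_def by (elim exE conjE)
  then have H_subset: "H \<subseteq> carrier_mat n n"
    and H: "group \<lparr>carrier = H, monoid.mult = (*), one = e\<rparr>"
    and iso: "G \<cong> \<lparr>carrier = H, monoid.mult = (*), one = e\<rparr>"
    by (simp_all add: semigroup_subgroup_def tropical_mat_monoid_def)
  let ?H = "\<lparr>carrier = H, monoid.mult = (*), one = e\<rparr>"
  interpret H: group ?H by (rule H)
  obtain I where I: "I \<subseteq> {1..n}" "\<And>j. j \<in> {1..n} \<Longrightarrow> column_in_span e I j"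
    "\<And>i. i \<in> I \<Longrightarrow> \<not> column_in_span e (I - {i}) i"
    using minimal_spanning_columns[of n e] by blast
  interpret tropical_matrix_group n H e I
  proof
    show "\<exists>h\<in>H. h * g = e \<and> g * h = e" if "g \<in> H" for g
      using H.l_inv H.r_inv H.inv_closed that
      by (intro bexI[of _ "inv\<^bsub>?H\<^esub> g"]) simp_all
  qed (use H_subset I H.one_closed H.m_closed H.l_one H.r_one in simp_all)
  interpret hom: group_hom ?H "wreath_sym real_group n" to_wreath
    by (intro group_hom.intro group_hom_axioms.intro H group_wreath_sym group_real_group homI)
      (simp_all add: to_wreath_carrier to_wreath_mult)
  \<comment> \<open>The required \<open>K\<close> is the image of the injective homomorphism
    \<open>to_wreath\<close>.\<close>
  have "subgroup (to_wreath ` H) (wreath_sym real_group n)"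
    using hom.img_is_subgroup by simp
  moreover have "to_wreath \<in> iso ?H ((wreath_sym real_group n)\<lparr>carrier := to_wreath ` H\<rparr>)"
    using inj_on_to_wreath
    by (intro isoI homI) (simp_all add: to_wreath_mult mult_H bij_betw_def)
  then have "G \<cong> (wreath_sym real_group n)\<lparr>carrier := to_wreath ` H\<rparr>"
    using iso iso_trans unfolding is_iso_def by blast
  ultimately show ?thesis by blast
qed

theorem theorem2p7:
  fixes G :: "('a, 'b) monoid_scheme" and n :: nat
  assumes "group G"
  shows "has_faithful_tropical_rep G n \<longleftrightarrow>
    (\<exists>K. subgroup K (wreath_sym real_group n) \<and>
      G \<cong> (wreath_sym real_group n)\<lparr>carrier := K\<rparr>)"
  using wreath_subgroup_if_has_faithful_tropical_rep has_faithful_tropical_rep_if_wreath_subgroup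
  by blast

end
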